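(* Consider a tenable, nontriangular (i.e. $a_m\ne0$ and $b_0\neq 0$) balanced affine two-colour urn with multiple drawings (under model $\mathcal M$ or model $\mathcal R$), with $T_0+m(a_{m-1}-a_m)>0$ and large index $\frac12<\Lambda<1$, where $\Lambda=\frac m\sigma(a_{m-1}-a_m)$. Let $g_n=\prod_{j=0}^{n-1}\frac{T_j}{T_j+m(a_{m-1}-a_m)}$. Then the random variable $\mathcal W_n=g_n(W_n-\mathbb E[W_n])$ converges almost surely and in $L_2$ to a limit $\mathcal W_\infty$.
   Context: Urn setting. Let $m\ge1$ be an integer (sample size), and let $a_k,b_k$ ($0\le k\le m$) be integers with $a_k+b_k=\sigma$ for all $k$ (the urn is balanced), where $\sigma\ge1$. The urn starts with $W_0,B_0\in\mathbb N_0$ white and black balls, $T_0=W_0+B_0\ge m$. At step $n\ge1$ a sample of $m$ balls is drawn from the urn, which contains $W_{n-1}$ white and $B_{n-1}$ black balls; the sample is returned, and if it contained $k$ white and $m-k$ black balls, then $a_{m-k}$ white and $b_{m-k}$ black balls are added (negative numbers mean removal). Thus $T_n=W_n+B_n=T_0+\sigma n$. $\mathbb F_n$ is the $\sigma$-field generated by the first $n$ draws. Sampling models. Given $\mathbb F_{n-1}$, the probability that the $n$-th sample contains exactly $k$ white balls ($0\le k\le m$) is $\binom{W_{n-1}}{k}\binom{T_{n-1}-W_{n-1}}{m-k}\big/\binom{T_{n-1}}{m}$ in model $\mathcal M$ (without replacement) and $\binom mk W_{n-1}^k(T_{n-1}-W_{n-1})^{m-k}/T_{n-1}^m$ in model $\mathcal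 R$ (with replacement). Tenability: in model $\mathcal M$, $a_k\ge-(m-k)$ and $b_k\ge -k$ for $0\le k\le m$; in model $\mathcal R$, $a_k\ge-1$ for $0\le k\le m-1$, $a_m\ge0$, $b_k\ge-1$ for $1\le k\le m$, $b_0\ge0$. Affine urn: $a_k=(m-k)a_{m-1}-(m-k-1)a_m$ for $0\le k\le m$. *)

theory Defs
  imports "HOL-Probability.Probability"
begin

text \<open>
  The number \<open>m\<close> is the sample size.  The entries \<open>a k\<close> and \<open>b k\<close> matter only for \<open>k \<le> m\<close>;
  a sample containing \<open>k\<close> white balls leads to the addition of \<open>a (m - k)\<close> white and
  \<open>b (m - k)\<close> black balls.
\<close>

datatype sampling_model = Without_Replacement | With_Replacement

definition balanced_urn :: "nat \<Rightarrow> (nat \<Rightarrow> int) \<Rightarrow> (nat \<Rightarrow> int) \<Rightarrow> int \<Rightarrow> bool" where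
  "balanced_urn m a b \<sigma> \<longleftrightarrow> (\<forall>k\<le>m. a k + b k = \<sigma>)"

definition affine_urn :: "nat \<Rightarrow> (nat \<Rightarrow> int) \<Rightarrow> bool" where
  "affine_urn m a \<longleftrightarrow>
     (\<forall>k\<le>m. a k = (int m - int k) * a (m - 1) - (int m - int k - 1) * a m)"

fun tenable_urn :: "sampling_model \<Rightarrow> nat \<Rightarrow> (nat \<Rightarrow> int) \<Rightarrow> (nat \<Rightarrow> int) \<Rightarrow> bool" where
  "tenable_urn Without_Replacement m a b \<longleftrightarrow>
     (\<forall>k\<le>m. a k \<ge> - (int m - int k) \<and> b k \<ge> - int k)"
| "tenable_urn With_Replacement m a b \<longleftrightarrow>
     (\<forall>k<m. a k \<ge> -1) \<and> a m \<ge> 0 \<and> (\<forall>k\<in>{1..m}. b k \<ge> -1) \<and> b 0 \<ge> 0"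

definition nontriangular_urn :: "nat \<Rightarrow> (nat \<Rightarrow> int) \<Rightarrow> (nat \<Rightarrow> int) \<Rightarrow> bool" where
  "nontriangular_urn m a b \<longleftrightarrow> a m \<noteq> 0 \<and> b 0 \<noteq> 0"

definition urn_index :: "nat \<Rightarrow> (nat \<Rightarrow> int) \<Rightarrow> int \<Rightarrow> real" where
  "urn_index m a \<sigma> = real m / real_of_int \<sigma> * real_of_int (a (m - 1) - a m)"

definition total_balls :: "int \<Rightarrow> nat \<Rightarrow> nat \<Rightarrow> nat \<Rightarrow> int" where
  "total_balls \<sigma> W\<^sub>0 B\<^sub>0 n = int W\<^sub>0 + int B\<^sub>0 + \<sigma> * int n"

text \<open>
  \<open>K n \<omega>\<close>, for \<open>n \<ge> 1\<close>, is the number of white balls in the \<open>n\<close>-th sample; \<open>K 0\<close> is never used.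
\<close>

primrec white_balls :: "nat \<Rightarrow> (nat \<Rightarrow> int) \<Rightarrow> nat \<Rightarrow> (nat \<Rightarrow> 'w \<Rightarrow> nat) \<Rightarrow> nat \<Rightarrow> 'w \<Rightarrow> int" where
  "white_balls m a W\<^sub>0 K 0 \<omega> = int W\<^sub>0"
| "white_balls m a W\<^sub>0 K (Suc n) \<omega> = white_balls m a W\<^sub>0 K n \<omega> + a (m - K (Suc n) \<omega>)"

primrec black_balls :: "nat \<Rightarrow> (nat \<Rightarrow> int) \<Rightarrow> nat \<Rightarrow> (nat \<Rightarrow> 'w \<Rightarrow> nat) \<Rightarrow> nat \<Rightarrow> 'w \<Rightarrow> int" where
  "black_balls m b B\<^sub>0 K 0 \<omega> = int B\<^sub>0"
| "black_balls m b B\<^sub>0 K (Suc n) \<omega> = black_balls m b B\<^sub>0 K n \<omega> + b (m - K (Suc n) \<omega>)"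

lemma white_plus_black_balls:
  assumes "balanced_urn m a b \<sigma>"
  shows "white_balls m a W\<^sub>0 K n \<omega> + black_balls m b B\<^sub>0 K n \<omega> = total_balls \<sigma> W\<^sub>0 B\<^sub>0 n"
proof (induction n)
  case 0
  show ?case by (simp add: total_balls_def)
next
  case (Suc n)
  have "a (m - K (Suc n) \<omega>) + b (m - K (Suc n) \<omega>) = \<sigma>"
    using assms by (auto simp: balanced_urn_def)
  with Suc show ?case by (simp add: total_balls_def algebra_simps)
qed

text \<open>
  \<open>sample_prob mdl m T w k\<close> is the probability that a sample of size \<open>m\<close> from an urn with \<open>T\<close> balls,
  \<open>w\<close> of them white, contains exactly \<open>k\<close> white balls.  The truncation in \<open>nat\<close> is harmless:
  in a tenable urn \<open>0 \<le> w \<le> T\<close> holds almost surely.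
\<close>

fun sample_prob :: "sampling_model \<Rightarrow> nat \<Rightarrow> int \<Rightarrow> int \<Rightarrow> nat \<Rightarrow> real" where
  "sample_prob Without_Replacement m T w k =
     real (nat w choose k) * real (nat (T - w) choose (m - k)) / real (nat T choose m)"
| "sample_prob With_Replacement m T w k =
     real (m choose k) * real_of_int w ^ k * real_of_int (T - w) ^ (m - k) / real_of_int T ^ m"

definition draw_algebra :: "'w measure \<Rightarrow> (nat \<Rightarrow> 'w \<Rightarrow> nat) \<Rightarrow> nat \<Rightarrow> 'w measure" where
  "draw_algebra M K n = sigma (space M) {K i -` A \<inter> space M | i A. i \<in> {1..n}}"

definition urn_process ::
  "'w measure \<Rightarrow> sampling_model \<Rightarrow> nat \<Rightarrow> (nat \<Rightarrow> int) \<Rightarrow> int \<Rightarrow> nat \<Rightarrow> nat \<Rightarrow> (nat \<Rightarrow> 'w \<Rightarrow> nat) \<Rightarrow> bool"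
where
  "urn_process M mdl m a \<sigma> W\<^sub>0 B\<^sub>0 K \<longleftrightarrow>
     prob_space M \<and>
     (\<forall>n\<ge>1. K n \<in> measurable M (count_space {..m})) \<and>
     (\<forall>n\<ge>1. \<forall>k\<le>m. AE \<omega> in M.
        real_cond_exp M (draw_algebra M K (n - 1)) (indicat_real {\<omega> \<in> space M. K n \<omega> = k}) \<omega>
        = sample_prob mdl m (total_balls \<sigma> W\<^sub>0 B\<^sub>0 (n - 1)) (white_balls m a W\<^sub>0 K (n - 1) \<omega>) k)"

definition urn_scaling :: "nat \<Rightarrow> (nat \<Rightarrow> int) \<Rightarrow> int \<Rightarrow> nat \<Rightarrow> nat \<Rightarrow> nat \<Rightarrow> real" where
  "urn_scaling m a \<sigma> W\<^sub>0 B\<^sub>0 n =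
     (\<Prod>j<n. real_of_int (total_balls \<sigma> W\<^sub>0 B\<^sub>0 j) /
        real_of_int (total_balls \<sigma> W\<^sub>0 B\<^sub>0 j + int m * (a (m - 1) - a m)))"

definition normalized_white ::
  "'w measure \<Rightarrow> nat \<Rightarrow> (nat \<Rightarrow> int) \<Rightarrow> int \<Rightarrow> nat \<Rightarrow> nat \<Rightarrow> (nat \<Rightarrow> 'w \<Rightarrow> nat) \<Rightarrow> nat \<Rightarrow> 'w \<Rightarrow> real"
where
  "normalized_white M m a \<sigma> W\<^sub>0 B\<^sub>0 K n \<omega> =
     urn_scaling m a \<sigma> W\<^sub>0 B\<^sub>0 n *
     (real_of_int (white_balls m a W\<^sub>0 K n \<omega>)
      - (LINT \<omega>'|M. real_of_int (white_balls m a W\<^sub>0 K n \<omega>')))"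

definition square_integrable :: "'w measure \<Rightarrow> ('w \<Rightarrow> real) \<Rightarrow> bool" where
  "square_integrable M X \<longleftrightarrow> X \<in> borel_measurable M \<and> integrable M (\<lambda>\<omega>. (X \<omega>)\<^sup>2)"

definition converges_L2 :: "'w measure \<Rightarrow> (nat \<Rightarrow> 'w \<Rightarrow> real) \<Rightarrow> ('w \<Rightarrow> real) \<Rightarrow> bool" where
  "converges_L2 M X Y \<longleftrightarrow>
     (\<forall>n. square_integrable M (X n)) \<and> square_integrable M Y \<and>
     (\<lambda>n. LINT \<omega>|M. (X n \<omega> - Y \<omega>)\<^sup>2) \<longlonglongrightarrow> 0"

end

theory Submission
  imports Defs
begin

text \<open>
  In an affine urn the number of added white balls is \<open>a m + (a (m - 1) - a m) * k\<close> when the sample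
  contains \<open>k\<close> white balls, and \<open>k\<close> has conditional mean \<open>m * W / T\<close> under both sampling models.  Hence
  the normalised process is a martingale whose \<open>n\<close>-th difference is at most
  \<open>g (n + 1) * (a (m - 1) - a m) * m\<close> in absolute value.  Since \<open>g n\<close> decays like \<open>n\<close> to the power
  \<open>- \<Lambda>\<close> and \<open>\<Lambda> > 1 / 2\<close>, the variances of the differences are summable.  Almost sure convergence
  follows from Kolmogorov's maximal inequality, and convergence in \<open>L\<^sub>2\<close> from Fatou's lemma.
\<close>

section \<open>Square-integrable martingale differences\<close>

lemma integrable_mult_square:
  fixes f g :: "'a \<Rightarrow> real"
  assumes [measurable]: "f \<in> borel_measurable M" "g \<in> borel_measurable M"
    and "integrable M (\<lambda>x. (f x)\<^sup>2)" "integrable M (\<lambda>x. (g x)\<^sup>2)"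
  shows "integrable M (\<lambda>x. f x * g x)"
proof (rule Bochner_Integration.integrable_bound)
  show "integrable M (\<lambda>x. (f x)\<^sup>2 + (g x)\<^sup>2)"
    using assms by auto
  show "AE x in M. norm (f x * g x) \<le> norm ((f x)\<^sup>2 + (g x)\<^sup>2)"
  proof (rule AE_I2)
    fix x
    have "2 * (\<bar>f x\<bar> * \<bar>g x\<bar>) \<le> \<bar>f x\<bar>\<^sup>2 + \<bar>g x\<bar>\<^sup>2"
      using sum_squares_bound[of "\<bar>f x\<bar>" "\<bar>g x\<bar>"] by (simp add: mult.assoc)
    moreover have "0 \<le> \<bar>f x\<bar> * \<bar>g x\<bar>" by simp
    ultimately show "norm (f x * g x) \<le> norm ((f x)\<^sup>2 + (g x)\<^sup>2)"
      unfolding real_norm_def abs_mult power2_abs by linarith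
  qed
qed simp

text \<open>Provides the locale in which the rules for \<open>real_cond_exp\<close> are stated;
  finiteness of the measure makes the sigma-finiteness automatic.\<close>

lemma (in prob_space) sigma_finite_subalgebraI:
  assumes "subalgebra M G"
  shows "sigma_finite_subalgebra M G"
proof -
  have "finite_measure_subalgebra M G"
    by unfold_locales (rule assms)
  then show ?thesis by (rule finite_measure_subalgebra_is_sigma_finite)
qed

text \<open>Indices are offset: \<open>D n\<close> is revealed at time \<open>n + 1\<close> and
  centred given \<open>F n\<close>, so a sum of the first \<open>n\<close> differences is known at
  time \<open>n\<close>. The filtration and differences are kept abstract because the locale is
  instantiated with restarted, stopped and urn differences.\<close>

locale martingale_differences = prob_space M for M :: "'a measure" +
  fixes F :: "nat \<Rightarrow> 'a measure" and D :: "nat \<Rightarrow> 'a \<Rightarrow> real"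
  assumes subalg: "\<And>n. subalgebra M (F n)"
    and filtration: "\<And>n. subalgebra (F (Suc n)) (F n)"
    and adapted: "\<And>n. D n \<in> borel_measurable (F (Suc n))"
    and square_integrable_diff: "\<And>n. integrable M (\<lambda>x. (D n x)\<^sup>2)"
    and cond_mean_zero: "\<And>n. AE x in M. real_cond_exp M (F n) (D n) x = 0"
begin

section \<open>Partial sums, orthogonality and second moments\<close>

definition S :: "nat \<Rightarrow> 'a \<Rightarrow> real" where
  "S n x = (\<Sum>j<n. D j x)"

lemma filtration_mono: "n \<le> k \<Longrightarrow> subalgebra (F k) (F n)"
proof (induction k rule: dec_induct)
  case base
  show ?case by (simp add: subalgebra_def)
next
  case (step k)
  then show ?case using filtration[of k] by (auto simp: subalgebra_def)
qed

lemma adapted_le: "j < n \<Longrightarrow> D j \<in> borel_measurable (F n)"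
  using measurable_from_subalg[OF filtration_mono adapted] by (simp add: Suc_le_eq)

lemma D_measurable [measurable]: "D n \<in> borel_measurable M"
  by (rule measurable_from_subalg[OF subalg adapted])

lemma S_adapted: "k \<le> n \<Longrightarrow> S k \<in> borel_measurable (F n)"
  unfolding S_def using adapted_le by (intro borel_measurable_sum) auto

lemma S_measurable [measurable]: "S n \<in> borel_measurable M"
  by (rule measurable_from_subalg[OF subalg S_adapted[OF order_refl]])

text \<open>A factor known at time \<open>n\<close> passes through the conditional expectation, and
  that of \<open>D n\<close> vanishes. With the factor \<open>S n\<close> this removes the cross
  term from the second moment.\<close>

lemma orthogonal:
  assumes Z: "Z \<in> borel_measurable (F n)" and "integrable M (\<lambda>x. Z x * D n x)"
  shows "(\<integral>x. Z x * D n x \<partial>M) = 0"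
proof -
  interpret sigma_finite_subalgebra M "F n" by (rule sigma_finite_subalgebraI[OF subalg])
  have [measurable]: "Z \<in> borel_measurable M"
    by (rule measurable_from_subalg[OF subalg Z])
  have "(\<integral>x. Z x * D n x \<partial>M) = (\<integral>x. Z x * real_cond_exp M (F n) (D n) x \<partial>M)"
    using real_cond_exp_intg(2)[OF assms(2) Z] by simp
  also have "\<dots> = (\<integral>x. 0 \<partial>M)"
    using cond_mean_zero[of n] by (intro integral_cong_AE) auto
  finally show ?thesis by simp
qed

lemma second_moment:
  "integrable M (\<lambda>x. (S n x)\<^sup>2)" "(\<integral>x. (S n x)\<^sup>2 \<partial>M) = (\<Sum>j<n. \<integral>x. (D j x)\<^sup>2 \<partial>M)"
proof (induction n)
  case 0
  { case 1 show ?case by (simp add: S_def) }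
  { case 2 show ?case by (simp add: S_def) }
next
  case (Suc n)
  have eq: "(S (Suc n) x)\<^sup>2 = (S n x)\<^sup>2 + 2 * (S n x * D n x) + (D n x)\<^sup>2" for x
    by (simp add: S_def power2_sum)
  have int: "integrable M (\<lambda>x. S n x * D n x)"
    using Suc square_integrable_diff by (intro integrable_mult_square) auto
  { case 1 show ?case
      unfolding eq using Suc int square_integrable_diff[of n] by auto }
  { case 2 show ?case
      unfolding eq using Suc int square_integrable_diff[of n]
        orthogonal[OF S_adapted[OF order_refl] int] by simp }
qed

section \<open>Restarting at time \<open>n\<close>, so that results on partial sums apply to the
  increments after \<open>n\<close>\<close>

lemma shift: "martingale_differences M (\<lambda>k. F (n + k)) (\<lambda>k. D (n + k))"
  by unfold_locales
    (use subalg filtration adapted square_integrable_diff cond_mean_zero in auto)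

lemma shift_S: "martingale_differences.S (\<lambda>k. D (n + k)) k x = S (n + k) x - S n x"
proof -
  have "S (n + k) x = S n x + (\<Sum>j<k. D (n + j) x)"
    unfolding S_def by (induction k) auto
  then show ?thesis
    by (simp add: martingale_differences.S_def[OF shift])
qed

lemma summable_shift:
  "summable (\<lambda>k. \<integral>x. (D k x)\<^sup>2 \<partial>M) \<Longrightarrow> summable (\<lambda>k. \<integral>x. (D (n + k) x)\<^sup>2 \<partial>M)"
  using summable_ignore_initial_segment[of "\<lambda>k. \<integral>x. (D k x)\<^sup>2 \<partial>M" n] by (simp add: add.commute)

section \<open>Stopping and maximal inequalities\<close>

definition stopped :: "real \<Rightarrow> nat \<Rightarrow> 'a \<Rightarrow> real" where
  "stopped \<epsilon> j x = (if \<forall>i\<le>j. \<bar>S i x\<bar> < \<epsilon> then 1 else 0) * D j x"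

text \<open>The factor in front of \<open>D n\<close> inspects only \<open>S 0\<close> to
  \<open>S n\<close>, hence is known at time \<open>n\<close> and can be pulled out of the
  conditional expectation; being 0 or 1, it also preserves square integrability.\<close>

lemma stopped_martingale_differences: "martingale_differences M F (stopped \<epsilon>)"
proof
  fix n
  define Z where "Z x = (if \<forall>i\<le>n. \<bar>S i x\<bar> < \<epsilon> then 1 else 0 :: real)" for x
  have Z: "Z \<in> borel_measurable (F n)"
  proof -
    have [measurable]: "S i \<in> borel_measurable (F n)" if "i \<in> {..n}" for i
      using S_adapted that by auto
    have "Measurable.pred (F n) (\<lambda>x. \<forall>i\<in>{..n}. \<bar>S i x\<bar> < \<epsilon>)"
      by measurable
    then show ?thesis unfolding Z_def by (auto simp: Ball_def)
  qed
  have [measurable]: "Z \<in> borel_measurable M"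
    by (rule measurable_from_subalg[OF subalg Z])
  have eq: "stopped \<epsilon> n = (\<lambda>x. Z x * D n x)"
    by (simp add: stopped_def Z_def fun_eq_iff)
  have "Z \<in> borel_measurable (F (Suc n))"
    by (rule measurable_from_subalg[OF filtration Z])
  then show "stopped \<epsilon> n \<in> borel_measurable (F (Suc n))"
    unfolding eq using adapted by auto
  show "integrable M (\<lambda>x. (stopped \<epsilon> n x)\<^sup>2)"
    unfolding eq by (rule Bochner_Integration.integrable_bound[OF square_integrable_diff[of n]])
      (auto simp: Z_def)
  interpret sigma_finite_subalgebra M "F n" by (rule sigma_finite_subalgebraI[OF subalg])
  have "integrable M (\<lambda>x. (Z x)\<^sup>2)"
    by (rule integrable_const_bound[of _ 1]) (auto simp: Z_def)
  then have "integrable M (\<lambda>x. Z x * D n x)"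
    using square_integrable_diff by (intro integrable_mult_square) auto
  then have "AE x in M. real_cond_exp M (F n) (stopped \<epsilon> n) x = Z x * real_cond_exp M (F n) (D n) x"
    unfolding eq by (intro real_cond_exp_mult Z) auto
  with cond_mean_zero[of n] show "AE x in M. real_cond_exp M (F n) (stopped \<epsilon> n) x = 0"
    by eventually_elim simp
qed (rule subalg filtration)+

text \<open>The stopped sum freezes at the first index \<open>k0\<close> at which the level is
  reached: differences before \<open>k0\<close> are kept, those from \<open>k0\<close> on are
  erased, so its value is \<open>S k0\<close>.\<close>

lemma stopped_sum:
  assumes "k \<le> N" "\<epsilon> \<le> \<bar>S k x\<bar>"
  shows "\<epsilon> \<le> \<bar>\<Sum>j<N. stopped \<epsilon> j x\<bar>"
proof -
  define k0 where "k0 = (LEAST k. \<epsilon> \<le> \<bar>S k x\<bar>)"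
  have k0: "\<epsilon> \<le> \<bar>S k0 x\<bar>"
    unfolding k0_def using assms(2) by (rule LeastI)
  have below: "\<bar>S i x\<bar> < \<epsilon>" if "i < k0" for i
    using not_less_Least[OF that[unfolded k0_def]] by simp
  have "k0 \<le> N"
    unfolding k0_def using assms by (meson Least_le le_trans)
  then have "(\<Sum>j<N. stopped \<epsilon> j x) = (\<Sum>j<k0. stopped \<epsilon> j x)"
    using k0 by (intro sum.mono_neutral_right) (auto simp: stopped_def not_less)
  also have "\<dots> = S k0 x"
    unfolding S_def by (intro sum.cong) (auto simp: stopped_def intro: below)
  finally show ?thesis using k0 by simp
qed

text \<open>
  Kolmogorov's maximal inequality: replacing \<open>D\<close> by the stopped differences turns the event
  that some partial sum is large into the event that the last one is.
\<close>

lemma maximal_inequality: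
  assumes "\<epsilon> > 0"
  shows "prob {x \<in> space M. \<exists>k\<le>N. \<epsilon> \<le> \<bar>S k x\<bar>} \<le> (\<Sum>j<N. \<integral>x. (D j x)\<^sup>2 \<partial>M) / \<epsilon>\<^sup>2"
proof -
  interpret st: martingale_differences M F "stopped \<epsilon>"
    by (rule stopped_martingale_differences)
  have "prob {x \<in> space M. \<exists>k\<le>N. \<epsilon> \<le> \<bar>S k x\<bar>} \<le> prob {x \<in> space M. \<epsilon>\<^sup>2 \<le> (st.S N x)\<^sup>2}"
  proof (rule finite_measure_mono)
    show "{x \<in> space M. \<exists>k\<le>N. \<epsilon> \<le> \<bar>S k x\<bar>} \<subseteq> {x \<in> space M. \<epsilon>\<^sup>2 \<le> (st.S N x)\<^sup>2}"
    proof safe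
      fix x k assume "k \<le> N" "\<epsilon> \<le> \<bar>S k x\<bar>"
      then have "\<epsilon> \<le> \<bar>st.S N x\<bar>"
        using stopped_sum by (auto simp: st.S_def)
      then show "\<epsilon>\<^sup>2 \<le> (st.S N x)\<^sup>2"
        using assms power_mono[of \<epsilon> "\<bar>st.S N x\<bar>" 2] by simp
    qed
  qed measurable
  also have "\<dots> \<le> (\<integral>x. (st.S N x)\<^sup>2 \<partial>M) / \<epsilon>\<^sup>2"
    using integral_Markov_inequality_measure[OF st.second_moment(1)[of N], of "{}" "\<epsilon>\<^sup>2"] assms
    by simp
  \<comment> \<open>Orthogonality of the stopped differences gives their variance sum, and erasing
    differences can only decrease it.\<close>
  also have "\<dots> \<le> (\<Sum>j<N. \<integral>x. (D j x)\<^sup>2 \<partial>M) / \<epsilon>\<^sup>2"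
    unfolding st.second_moment(2)
    by (intro divide_right_mono sum_mono integral_mono st.square_integrable_diff
        square_integrable_diff) (auto simp: stopped_def)
  finally show ?thesis .
qed

text \<open>The finite bound is uniform in the horizon \<open>N\<close>, and the events increase
  with \<open>N\<close>, so continuity from below applies.\<close>

lemma maximal_inequality_infinite:
  assumes "\<epsilon> > 0" and "summable (\<lambda>n. \<integral>x. (D n x)\<^sup>2 \<partial>M)"
  shows "prob {x \<in> space M. \<exists>k. \<epsilon> \<le> \<bar>S k x\<bar>} \<le> (\<Sum>n. \<integral>x. (D n x)\<^sup>2 \<partial>M) / \<epsilon>\<^sup>2"
proof -
  define A where "A N = {x \<in> space M. \<exists>k\<le>N. \<epsilon> \<le> \<bar>S k x\<bar>}" for N
  have "range A \<subseteq> events"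
    unfolding A_def by auto
  moreover have "incseq A"
    unfolding A_def by (intro monoI) (use le_trans in blast)
  ultimately have "(\<lambda>N. prob (A N)) \<longlonglongrightarrow> prob (\<Union>N. A N)"
    by (rule finite_Lim_measure_incseq)
  moreover have "(\<Union>N. A N) = {x \<in> space M. \<exists>k. \<epsilon> \<le> \<bar>S k x\<bar>}"
    unfolding A_def by auto
  moreover have "prob (A N) \<le> (\<Sum>n. \<integral>x. (D n x)\<^sup>2 \<partial>M) / \<epsilon>\<^sup>2" for N
    unfolding A_def using maximal_inequality[OF assms(1), of N] assms(2)
    by (elim order_trans) (intro divide_right_mono sum_le_suminf, auto)
  ultimately show ?thesis
    by (metis LIMSEQ_le_const2)
qed

section \<open>Almost sure and mean square convergence\<close>

lemma AE_convergent:
  assumes summable: "summable (\<lambda>n. \<integral>x. (D n x)\<^sup>2 \<partial>M)"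
  shows "AE x in M. convergent (\<lambda>n. S n x)"
proof -
  \<comment> \<open>The exceptional event \<open>B\<close> lies, for every \<open>n\<close>, in the
    event of the maximal inequality restarted at \<open>n\<close>. Its probability is thus below
    every tail of the variance series over \<open>\<epsilon>\<^sup>2\<close>, hence zero.\<close>
  have osc: "AE x in M. \<exists>n. \<forall>k. \<bar>S (n + k) x - S n x\<bar> < \<epsilon>" if "\<epsilon> > 0" for \<epsilon>
  proof -
    define B where "B = {x \<in> space M. \<forall>n. \<exists>k. \<epsilon> \<le> \<bar>S (n + k) x - S n x\<bar>}"
    have [measurable]: "B \<in> events" unfolding B_def by measurable
    have le: "prob B \<le> (\<Sum>k. \<integral>x. (D (n + k) x)\<^sup>2 \<partial>M) / \<epsilon>\<^sup>2" for n
    proof -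
      interpret sh: martingale_differences M "\<lambda>k. F (n + k)" "\<lambda>k. D (n + k)"
        by (rule shift)
      have "prob B \<le> prob {x \<in> space M. \<exists>k. \<epsilon> \<le> \<bar>sh.S k x\<bar>}"
        by (rule finite_measure_mono) (auto simp: B_def shift_S)
      also have "\<dots> \<le> (\<Sum>k. \<integral>x. (D (n + k) x)\<^sup>2 \<partial>M) / \<epsilon>\<^sup>2"
        by (intro sh.maximal_inequality_infinite that summable_shift summable)
      finally show ?thesis .
    qed
    have "(\<lambda>n. (\<Sum>k. \<integral>x. (D (n + k) x)\<^sup>2 \<partial>M) / \<epsilon>\<^sup>2) \<longlonglongrightarrow> 0 / \<epsilon>\<^sup>2"
    proof (intro tendsto_divide tendsto_const)
      show "(\<lambda>n. \<Sum>k. \<integral>x. (D (n + k) x)\<^sup>2 \<partial>M) \<longlonglongrightarrow> 0"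
        using suminf_exist_split2[OF summable] by (simp add: add.commute)
    qed (use that in auto)
    then have "prob B \<le> 0 / \<epsilon>\<^sup>2"
      by (rule LIMSEQ_le_const) (simp add: le)
    then have "prob B = 0" by (simp add: measure_le_0_iff)
    then have "AE x in M. x \<notin> B"
      using prob_eq_0[of B] by simp
    then show ?thesis
      by (rule AE_mp) (auto simp: B_def not_le)
  qed
  \<comment> \<open>Countably many tolerances leave a single null set; outside it, comparing later
    sums through \<open>S n\<close> yields the Cauchy property.\<close>
  have "AE x in M. \<forall>i. \<exists>n. \<forall>k. \<bar>S (n + k) x - S n x\<bar> < inverse (real (Suc i))"
    unfolding AE_all_countable using osc by simp
  then show ?thesis
  proof eventually_elim
    case (elim x)
    show ?case
      unfolding Cauchy_convergent_iff[symmetric]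
    proof (rule metric_CauchyI)
      fix e :: real assume "e > 0"
      then obtain i where i: "inverse (real (Suc i)) < e / 2"
        using reals_Archimedean[of "e / 2"] by auto
      obtain n where n: "\<And>k. \<bar>S (n + k) x - S n x\<bar> < inverse (real (Suc i))"
        using elim by blast
      have "\<bar>S k x - S n x\<bar> < e / 2" if "k \<ge> n" for k
        using n[of "k - n"] that i by simp
      then show "\<exists>N. \<forall>k\<ge>N. \<forall>l\<ge>N. dist (S k x) (S l x) < e"
        unfolding dist_real_def by (intro exI[of _ n] allI impI) (smt (verit) field_sum_of_halves)
    qed
  qed
qed

theorem convergence:
  assumes summable: "summable (\<lambda>n. \<integral>x. (D n x)\<^sup>2 \<partial>M)"
  obtains L where "AE x in M. (\<lambda>n. S n x) \<longlonglongrightarrow> L x" and "converges_L2 M S L"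
proof
  \<comment> \<open>Where the sums diverge, \<open>lim\<close> is unspecified, but this happens only
    on a null set.\<close>
  define L where "L x = lim (\<lambda>n. S n x)" for x
  have [measurable]: "L \<in> borel_measurable M"
    unfolding L_def by measurable
  show AE_L: "AE x in M. (\<lambda>n. S n x) \<longlonglongrightarrow> L x"
    using AE_convergent[OF summable]
    by eventually_elim (simp add: L_def convergent_LIMSEQ_iff)
  define R where "R n = (\<Sum>k. \<integral>x. (D (n + k) x)\<^sup>2 \<partial>M)" for n
  have R_nonneg: "R n \<ge> 0" for n
    unfolding R_def by (intro suminf_nonneg summable_shift summable) simp
  \<comment> \<open>Fatou's lemma along the increments \<open>S (n + k) - S n\<close>, whose second
    moments are partial sums of the tail \<open>R n\<close>. The nonnegative integral is used
    because integrability of the square is only deduced from this bound.\<close>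
  have bound: "(\<integral>\<^sup>+x. ennreal ((S n x - L x)\<^sup>2) \<partial>M) \<le> ennreal (R n)" for n
  proof -
    interpret sh: martingale_differences M "\<lambda>k. F (n + k)" "\<lambda>k. D (n + k)"
      by (rule shift)
    have "(\<integral>\<^sup>+x. ennreal ((S n x - L x)\<^sup>2) \<partial>M)
        = (\<integral>\<^sup>+x. liminf (\<lambda>k. ennreal ((S (n + k) x - S n x)\<^sup>2)) \<partial>M)"
    proof (rule nn_integral_cong_AE, use AE_L in eventually_elim)
      case (elim x)
      have "(\<lambda>k. S (k + n) x) \<longlonglongrightarrow> L x"
        using elim by (rule LIMSEQ_ignore_initial_segment)
      then have "(\<lambda>k. S (n + k) x) \<longlonglongrightarrow> L x" by (simp add: add.commute)
      then have "(\<lambda>k. ennreal ((S (n + k) x - S n x)\<^sup>2)) \<longlonglongrightarrow> ennreal ((L x - S n x)\<^sup>2)"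
        by (intro tendsto_ennrealI tendsto_intros)
      then show ?case
        unfolding power2_commute[of "S n x"]
        by (rule lim_imp_Liminf[OF sequentially_bot, symmetric])
    qed
    also have "\<dots> \<le> liminf (\<lambda>k. \<integral>\<^sup>+x. ennreal ((S (n + k) x - S n x)\<^sup>2) \<partial>M)"
      by (rule nn_integral_liminf) measurable
    also have "\<dots> \<le> ennreal (R n)"
    proof (intro Liminf_le always_eventually allI)
      show "sequentially \<noteq> bot" by simp
      fix k
      have "(\<integral>\<^sup>+x. ennreal ((S (n + k) x - S n x)\<^sup>2) \<partial>M) = ennreal (\<Sum>j<k. \<integral>x. (D (n + j) x)\<^sup>2 \<partial>M)"
        using sh.second_moment[of k] by (simp add: shift_S nn_integral_eq_integral)
      also have "\<dots> \<le> ennreal (R n)"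
        unfolding R_def
        by (intro ennreal_leI sum_le_suminf summable_shift summable) auto
      finally show "(\<integral>\<^sup>+x. ennreal ((S (n + k) x - S n x)\<^sup>2) \<partial>M) \<le> ennreal (R n)" .
    qed
    finally show ?thesis .
  qed
  have int: "integrable M (\<lambda>x. (S n x - L x)\<^sup>2)" for n
    using bound[of n] by (intro integrableI_nonneg) (auto simp: less_top[symmetric] top_unique)
  have le_R: "(\<integral>x. (S n x - L x)\<^sup>2 \<partial>M) \<le> R n" for n
    using bound[of n] int[of n] R_nonneg[of n] by (simp add: nn_integral_eq_integral)
  have R: "R \<longlonglongrightarrow> 0"
    unfolding R_def using suminf_exist_split2[OF summable] by (simp add: add.commute)
  have "(\<lambda>n. \<integral>x. (S n x - L x)\<^sup>2 \<partial>M) \<longlonglongrightarrow> 0"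
    by (rule tendsto_sandwich[OF _ _ tendsto_const R]) (simp_all add: le_R)
  \<comment> \<open>At \<open>n = 0\<close> the partial sum is zero, so the distance to
    \<open>L\<close> is \<open>L\<close> itself.\<close>
  moreover have "integrable M (\<lambda>x. (L x)\<^sup>2)"
    using int[of 0] by (simp add: S_def)
  moreover have "square_integrable M (S n)" for n
    using second_moment(1) by (simp add: square_integrable_def)
  ultimately show "converges_L2 M S L"
    unfolding converges_L2_def by (simp add: square_integrable_def)
qed

end

section \<open>The scaling factors and the mean of a sample\<close>

text \<open>For the urn, \<open>t\<close> is the initial total, \<open>s\<close> is
  \<open>\<sigma>\<close> and \<open>d\<close> is \<open>m * (a (m - 1) - a m)\<close>, so
  \<open>s < 2 * d\<close> says that the index exceeds 1/2. A telescoping bound replaces Gamma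
  function asymptotics.\<close>

lemma summable_square_scaling:
  fixes t s d :: real
  assumes "t > 0" "s \<ge> 0" "s < 2 * d"
  shows "summable (\<lambda>n. (\<Prod>j<Suc n. (t + s * real j) / (t + s * real j + d))\<^sup>2)"
proof -
  define g where "g n = (\<Prod>j<n. (t + s * real j) / (t + s * real j + d))" for n
  define v where "v n = (t + s * real n) * (g n)\<^sup>2" for n
  \<comment> \<open>\<open>v\<close> decreases because \<open>g n\<close> decays faster than \<open>n\<close> to the power \<open>- 1 / 2\<close>; its decrements dominate the series.\<close>
  have step: "(2 * d - s) * (g (Suc n))\<^sup>2 \<le> v n - v (Suc n)" for n
  proof -
    define T where "T = t + s * real n"
    \<comment> \<open>Factoring out \<open>q\<close> makes \<open>g n\<close> and
      \<open>g (Suc n)\<close> linear in \<open>T\<close>, so the decrement of \<open>v\<close>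
      becomes a polynomial identity with nonnegative remainder
      \<open>q\<^sup>2 * T * d\<^sup>2\<close>.\<close>
    define q where "q = g n / (T + d)"
    have "T > 0" "d > 0" unfolding T_def using assms by (auto intro: add_pos_nonneg)
    then have g: "g n = q * (T + d)" "g (Suc n) = q * T"
      by (simp_all add: q_def g_def T_def)
    have v: "v n = T * (g n)\<^sup>2" "v (Suc n) = (T + s) * (g (Suc n))\<^sup>2"
      by (simp_all add: v_def T_def algebra_simps)
    have "v n - v (Suc n) = (2 * d - s) * (g (Suc n))\<^sup>2 + q\<^sup>2 * T * d\<^sup>2"
      unfolding v g by (simp add: power2_eq_square algebra_simps)
    then show ?thesis
      using \<open>T > 0\<close> by simp
  qed
  have "(\<Sum>i<n. (2 * d - s) * (g (Suc i))\<^sup>2) \<le> v 0" for n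
  proof -
    have "(\<Sum>i<n. (2 * d - s) * (g (Suc i))\<^sup>2) \<le> (\<Sum>i<n. v i - v (Suc i))"
      by (intro sum_mono step)
    also have "\<dots> = v 0 - v n"
      by (rule sum_lessThan_telescope')
    also have "\<dots> \<le> v 0"
      using assms by (simp add: v_def)
    finally show ?thesis .
  qed
  then have "summable (\<lambda>i. (2 * d - s) * (g (Suc i))\<^sup>2)"
    using assms by (intro summableI_nonneg_bounded) auto
  then show ?thesis
    unfolding g_def using assms by (subst (asm) summable_cmult_iff) auto
qed

text \<open>Absorption turns \<open>k * (w choose k)\<close> into
  \<open>w * (w - 1 choose k - 1)\<close>, and Vandermonde's identity sums the rest. For
  \<open>w = 0\<close> both sides vanish, so the truncated subtraction does no harm.\<close>

lemma hypergeometric_mean: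
  "(\<Sum>k\<le>Suc m. k * (w choose k) * (v choose (Suc m - k))) = w * ((w + v - 1) choose m)"
proof (cases w)
  case (Suc w')
  have "(\<Sum>k\<le>Suc m. k * (w choose k) * (v choose (Suc m - k)))
      = (\<Sum>k\<le>m. Suc k * (Suc w' choose Suc k) * (v choose (m - k)))"
    unfolding Suc by (subst sum.atMost_Suc_shift) (simp del: binomial_Suc_Suc)
  also have "\<dots> = (\<Sum>k\<le>m. Suc w' * ((w' choose k) * (v choose (m - k))))"
    by (simp only: Suc_times_binomial mult.assoc)
  also have "\<dots> = Suc w' * ((w' + v) choose m)"
    by (simp only: sum_distrib_left[symmetric] vandermonde)
  finally show ?thesis by (simp add: Suc)
qed (auto simp: binomial_eq_0 intro!: sum.neutral gr0I)

text \<open>The same absorption step, followed by the binomial theorem.\<close>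

lemma binomial_mean:
  fixes w v :: real
  shows "(\<Sum>k\<le>Suc m. real k * (real (Suc m choose k) * w ^ k * v ^ (Suc m - k)))
    = real (Suc m) * w * (w + v) ^ m"
proof -
  have "(\<Sum>k\<le>Suc m. real k * (real (Suc m choose k) * w ^ k * v ^ (Suc m - k)))
      = (\<Sum>k\<le>m. real (Suc k * (Suc m choose Suc k)) * w ^ Suc k * v ^ (m - k))"
    by (subst sum.atMost_Suc_shift) (simp del: binomial_Suc_Suc of_nat_Suc mult_Suc add: mult.assoc)
  also have "\<dots> = (\<Sum>k\<le>m. real (Suc m) * w * (real (m choose k) * w ^ k * v ^ (m - k)))"
    by (simp only: Suc_times_binomial of_nat_mult power_Suc mult_ac)
  also have "\<dots> = real (Suc m) * w * (w + v) ^ m"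
    by (simp only: sum_distrib_left[symmetric] binomial_ring)
  finally show ?thesis .
qed

lemma sample_mean_without:
  assumes "1 \<le> m" "int m \<le> T" "0 \<le> w" "w \<le> T"
  shows "(\<Sum>k\<le>m. real k * sample_prob Without_Replacement m T w k) = real m * of_int w / of_int T"
proof -
  obtain m' where m: "m = Suc m'" using assms by (cases m) auto
  obtain T' where T: "nat T = Suc T'" using assms by (cases "nat T") auto
  have wv: "nat w + nat (T - w) = Suc T'" using assms T by linarith
  have "(\<Sum>k\<le>m. real k * sample_prob Without_Replacement m T w k)
      = real (\<Sum>k\<le>m. k * (nat w choose k) * (nat (T - w) choose (m - k))) / real (nat T choose m)"
    by (simp add: sum_divide_distrib mult.assoc)
  also have "\<dots> = real (nat w * (T' choose m')) / real (nat T choose m)"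
    unfolding m hypergeometric_mean by (simp add: wv)
  also have "\<dots> = real m * real (nat w) / real (nat T)"
  proof -
    \<comment> \<open>Absorption once more, now in the normalising constant; it converts the
      quotient of binomial coefficients into \<open>m / T\<close>.\<close>
    have "m * (nat T choose m) = nat T * (T' choose m')"
      unfolding m T by (rule Suc_times_binomial)
    then have "nat w * (T' choose m') * nat T = m * nat w * (nat T choose m)"
      by (metis mult.commute mult.left_commute)
    then have "real (nat w * (T' choose m')) * real (nat T)
        = real m * real (nat w) * real (nat T choose m)"
      by (simp only: of_nat_mult[symmetric])
    moreover have "nat T choose m \<noteq> 0"
      using assms by (simp add: le_nat_iff)
    ultimately show ?thesis
      using T by (subst frac_eq_eq) auto
  qed
  finally show ?thesis using assms by simp
qed

lemma sample_mean_with: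
  assumes "1 \<le> m" "0 < T"
  shows "(\<Sum>k\<le>m. real k * sample_prob With_Replacement m T w k) = real m * of_int w / of_int T"
proof -
  obtain m' where m: "m = Suc m'" using assms by (cases m) auto
  have "(\<Sum>k\<le>m. real k * sample_prob With_Replacement m T w k)
      = (\<Sum>k\<le>m. real k * (real (m choose k) * of_int w ^ k * of_int (T - w) ^ (m - k))) / of_int T ^ m"
    by (simp add: sum_divide_distrib)
  also have "\<dots> = real m * of_int w * of_int T ^ m' / of_int T ^ m"
    unfolding m binomial_mean by simp
  also have "\<dots> = real m * of_int w / of_int T"
    using assms by (simp add: m)
  finally show ?thesis .
qed

section \<open>The urn process\<close>

lemma space_draw_algebra [simp]: "space (draw_algebra M K n) = space M"
  by (simp add: draw_algebra_def space_measure_of_conv)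

lemma sets_draw_algebra:
  "sets (draw_algebra M K n) = sigma_sets (space M) {K i -` A \<inter> space M | i A. i \<in> {1..n}}"
  unfolding draw_algebra_def by (rule sets_measure_of) auto

lemma draw_measurable:
  assumes "1 \<le> i" "i \<le> n"
  shows "K i \<in> draw_algebra M K n \<rightarrow>\<^sub>M count_space UNIV"
  by (rule measurableI) (use assms in \<open>auto simp: sets_draw_algebra intro!: sigma_sets.Basic\<close>)

lemma draw_algebra_Suc: "subalgebra (draw_algebra M K (Suc n)) (draw_algebra M K n)"
proof -
  have "{K i -` A \<inter> space M | i A. i \<in> {1..n}} \<subseteq> {K i -` A \<inter> space M | i A. i \<in> {1..Suc n}}"
    by fastforce
  then show ?thesis
    by (simp add: subalgebra_def sets_draw_algebra sigma_sets_mono')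
qed

lemma white_balls_measurable:
  "white_balls m a W\<^sub>0 K n \<in> draw_algebra M K n \<rightarrow>\<^sub>M count_space UNIV"
proof -
  \<comment> \<open>The algebra stays fixed at time \<open>n\<close> while the induction runs over
    earlier times \<open>j\<close>.\<close>
  have "white_balls m a W\<^sub>0 K j \<in> draw_algebra M K n \<rightarrow>\<^sub>M count_space UNIV" if "j \<le> n" for j
    using that
  proof (induction j)
    case 0
    have "white_balls m a W\<^sub>0 K 0 = (\<lambda>_. int W\<^sub>0)" by (simp add: fun_eq_iff)
    then show ?case by simp
  next
    case (Suc j)
    have [measurable]: "white_balls m a W\<^sub>0 K j \<in> draw_algebra M K n \<rightarrow>\<^sub>M count_space UNIV"
      using Suc by simp
    have [measurable]: "K (Suc j) \<in> draw_algebra M K n \<rightarrow>\<^sub>M count_space UNIV"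
      using Suc.prems by (intro draw_measurable) auto
    have "white_balls m a W\<^sub>0 K (Suc j)
        = (\<lambda>x. white_balls m a W\<^sub>0 K j x + a (m - K (Suc j) x))"
      by (simp add: fun_eq_iff)
    then show ?case by simp
  qed
  then show ?thesis by blast
qed

locale affine_urn_process =
  fixes M :: "'w measure" and mdl :: sampling_model and m W\<^sub>0 B\<^sub>0 :: nat
    and a b :: "nat \<Rightarrow> int" and \<sigma> :: int and K :: "nat \<Rightarrow> 'w \<Rightarrow> nat"
  assumes m_pos: "m \<ge> 1" and \<sigma>_pos: "\<sigma> \<ge> 1" and start: "W\<^sub>0 + B\<^sub>0 \<ge> m"
    and balanced: "balanced_urn m a b \<sigma>"
    and tenable: "tenable_urn mdl m a b"
    and affine: "affine_urn m a"
    and scaling_pos: "int (W\<^sub>0 + B\<^sub>0) + int m * (a (m - 1) - a m) > 0"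
    and process: "urn_process M mdl m a \<sigma> W\<^sub>0 B\<^sub>0 K"
begin

sublocale prob_space M
  using process by (simp add: urn_process_def)

abbreviation "F \<equiv> draw_algebra M K"
abbreviation "white \<equiv> white_balls m a W\<^sub>0 K"
abbreviation "balls \<equiv> total_balls \<sigma> W\<^sub>0 B\<^sub>0"
abbreviation "W n x \<equiv> real_of_int (white n x)"
abbreviation "T n \<equiv> real_of_int (balls n)"
abbreviation "g \<equiv> urn_scaling m a \<sigma> W\<^sub>0 B\<^sub>0"
abbreviation "h \<equiv> real_of_int (a (m - 1) - a m)"

section \<open>Bounds, increments and integrability\<close>

lemma K_measurable': "K (Suc n) \<in> M \<rightarrow>\<^sub>M count_space {..m}"
  using process by (simp add: urn_process_def)

lemma K_le: "x \<in> space M \<Longrightarrow> K (Suc n) x \<le> m"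
  using measurable_space[OF K_measurable'] by simp

lemma K_measurable [measurable]: "K (Suc n) \<in> M \<rightarrow>\<^sub>M count_space UNIV"
  by (rule measurable_compose[OF K_measurable', of "\<lambda>k. k"]) simp

lemma draw_subalg: "subalgebra M (F n)"
proof -
  have "K i -` A \<inter> space M \<in> events" if "1 \<le> i" for i A
    using that K_measurable[of "i - 1"] by (intro measurable_sets[of _ _ "count_space UNIV"]) auto
  then show ?thesis
    unfolding subalgebra_def sets_draw_algebra space_draw_algebra
    by (intro conjI refl sets.sigma_sets_subset) auto
qed

lemma W_measurable [measurable]: "white n \<in> M \<rightarrow>\<^sub>M count_space UNIV"
  by (rule measurable_from_subalg[OF draw_subalg white_balls_measurable])

lemma total_ge: "int W\<^sub>0 + int B\<^sub>0 \<le> balls n"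
  using \<sigma>_pos by (simp add: total_balls_def)

lemma m_le_total: "int m \<le> balls n"
  using start total_ge[of n] by linarith

lemma total_pos: "0 < balls n"
  using m_le_total[of n] m_pos by linarith

lemma scaled_total_pos: "0 < T n + real m * h"
proof -
  have "0 < balls n + int m * (a (m - 1) - a m)"
    using scaling_pos total_ge[of n] by linarith
  then have "0 < real_of_int (balls n + int m * (a (m - 1) - a m))"
    by (simp only: of_int_0_less_iff)
  then show ?thesis by simp
qed

text \<open>Affinity makes the increment linear in the draw, so its conditional mean needs only that
  of the draw. On the space \<open>K (Suc n) x \<le> m\<close>, hence the subtraction
  \<open>m - K (Suc n) x\<close> is exact.\<close>

lemma W_Suc:
  assumes "x \<in> space M"
  shows "W (Suc n) x = W n x + real_of_int (a m) + h * real (K (Suc n) x)"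
proof -
  have "a (m - K (Suc n) x)
      = (int m - int (m - K (Suc n) x)) * a (m - 1) - (int m - int (m - K (Suc n) x) - 1) * a m"
    by (rule affine[unfolded affine_urn_def, rule_format]) simp
  also have "\<dots> = a m + (a (m - 1) - a m) * int (K (Suc n) x)"
    using K_le[OF assms, of n] by (simp add: of_nat_diff algebra_simps)
  finally show ?thesis by simp
qed

lemma K_integrable: "integrable M (\<lambda>x. real (K (Suc n) x))"
  by (rule integrable_const_bound[of _ "real m"]) (auto simp: K_le)

lemma W_integrable: "integrable M (\<lambda>x. W n x)"
proof (induction n)
  case (Suc n)
  have "integrable M (\<lambda>x. W n x + real_of_int (a m) + h * real (K (Suc n) x))"
    using Suc K_integrable by auto
  then show ?case
    by (subst Bochner_Integration.integrable_cong[OF refl W_Suc]) auto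
qed simp

section \<open>The conditional law of a draw and its mean\<close>

lemma sample_prob_measurable [measurable]:
  "(\<lambda>x. sample_prob mdl m (balls n) (white n x) k) \<in> borel_measurable (F n)"
  by (rule measurable_compose[OF white_balls_measurable]) simp

lemma cond_prob:
  assumes "k \<le> m"
  shows "AE x in M. real_cond_exp M (F n) (indicat_real {x \<in> space M. K (Suc n) x = k}) x
    = sample_prob mdl m (balls n) (white n x) k"
  using process assms unfolding urn_process_def
  by (elim conjE allE[of _ "Suc n"] allE[of _ k]) simp

text \<open>Impossible samples almost surely do not occur: the event \<open>A\<close> that value
  \<open>k\<close> has conditional probability zero is known at time \<open>n\<close>, so
  integrating that probability over \<open>A\<close> gives
  \<open>prob (A \<inter> E) = 0\<close>.\<close>

lemma AE_sample_prob_nonzero: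
  "AE x in M. sample_prob mdl m (balls n) (white n x) (K (Suc n) x) \<noteq> 0"
proof -
  have "AE x in M. K (Suc n) x = k \<longrightarrow> sample_prob mdl m (balls n) (white n x) k \<noteq> 0" if "k \<le> m" for k
  proof -
    interpret sigma_finite_subalgebra M "F n" by (rule sigma_finite_subalgebraI[OF draw_subalg])
    let ?p = "\<lambda>x. sample_prob mdl m (balls n) (white n x) k"
    define E where "E = {x \<in> space M. K (Suc n) x = k}"
    define A where "A = {x \<in> space M. ?p x = 0}"
    have [measurable]: "E \<in> events" unfolding E_def by measurable
    have "{x \<in> space (F n). ?p x = 0} \<in> sets (F n)" by measurable
    then have A: "A \<in> sets (F n)" by (simp add: A_def)
    then have [measurable]: "A \<in> events" using draw_subalg by (auto simp: subalgebra_def)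
    have int: "integrable M (\<lambda>x. indicat_real A x * indicat_real E x)"
      by (rule integrable_const_bound[of _ 1]) (auto simp: indicator_def)
    have "prob (A \<inter> E) = (\<integral>x. indicat_real A x * indicat_real E x \<partial>M)"
      by (simp add: indicator_inter_arith[symmetric])
    also have "\<dots> = (\<integral>x. indicat_real A x * real_cond_exp M (F n) (indicat_real E) x \<partial>M)"
      using A by (intro real_cond_exp_intg(2)[symmetric] int) auto
    also have "\<dots> = (\<integral>x. 0 \<partial>M)"
    proof (rule integral_cong_AE)
      show "AE x in M. indicat_real A x * real_cond_exp M (F n) (indicat_real E) x = 0"
        using cond_prob[OF that, of n] unfolding E_def[symmetric]
        by eventually_elim (auto simp: A_def indicator_def)
    qed auto
    finally have "AE x in M. x \<notin> A \<inter> E"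
      using prob_eq_0[of "A \<inter> E"] by simp
    then show ?thesis
      by (rule AE_mp) (auto simp: A_def E_def)
  qed
  then have "AE x in M. \<forall>k\<in>{..m}. K (Suc n) x = k \<longrightarrow> sample_prob mdl m (balls n) (white n x) k \<noteq> 0"
    by (intro AE_finite_allI) auto
  then show ?thesis
    by (rule AE_mp) (use K_le in auto)
qed

text \<open>
  Without replacement, the range of the number of white balls is needed for the sample mean because
  \<^const>\<open>sample_prob\<close> truncates at zero; with replacement the mean formula holds for every integer.
\<close>

lemma AE_white_range:
  assumes mdl: "mdl = Without_Replacement"
  shows "AE x in M. 0 \<le> white n x \<and> white n x \<le> balls n"
proof (induction n)
  case 0
  show ?case by (simp add: total_balls_def)
next
  case (Suc n)
  show ?case
    using Suc.IH AE_sample_prob_nonzero[of n] AE_space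
  proof eventually_elim
    case (elim x)
    define k where "k = K (Suc n) x"
    have k: "k \<le> m" unfolding k_def using elim K_le by auto
    have "sample_prob mdl m (balls n) (white n x) k \<noteq> 0"
      using elim by (simp add: k_def)
    \<comment> \<open>Both binomial coefficients in the numerator are nonzero, so the urn holds the
      balls of the sample; tenability never removes more than these.\<close>
    then have *: "int k \<le> white n x" "int (m - k) \<le> balls n - white n x"
      using elim unfolding mdl by (auto simp: not_less[symmetric] binomial_eq_0)
    have "a (m - k) \<ge> - int k" "b (m - k) \<ge> - int (m - k)"
      using tenable k unfolding mdl by (auto simp: of_nat_diff dest: spec[of _ "m - k"])
    moreover have "a (m - k) + b (m - k) = \<sigma>"
      using balanced by (simp add: balanced_urn_def)
    moreover have "balls (Suc n) = balls n + \<sigma>"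
      by (simp add: total_balls_def algebra_simps)
    ultimately show ?case
      using * by (simp add: k_def)
  qed
qed

lemma AE_sample_mean:
  "AE x in M. (\<Sum>k\<le>m. real k * sample_prob mdl m (balls n) (white n x) k) = real m * W n x / T n"
proof (cases mdl)
  case Without_Replacement
  show ?thesis
    using AE_white_range[OF Without_Replacement, of n] 
    by eventually_elim (use m_pos m_le_total[of n] in \<open>simp only: Without_Replacement sample_mean_without\<close>)
next
  case With_Replacement
  show ?thesis
    by (simp only: With_Replacement sample_mean_with[OF m_pos total_pos]) simp
qed

text \<open>The draw is a finite combination of the indicators of its values, so linearity reduces
  its conditional mean to the mean of \<open>sample_prob\<close>.\<close>

lemma cond_mean:
  "AE x in M. real_cond_exp M (F n) (\<lambda>x. real (K (Suc n) x)) x = real m * W n x / T n"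
proof -
  interpret sigma_finite_subalgebra M "F n" by (rule sigma_finite_subalgebraI[OF draw_subalg])
  define E where "E k = {x \<in> space M. K (Suc n) x = k}" for k
  have [measurable]: "E k \<in> events" for k unfolding E_def by measurable
  have int_E: "integrable M (indicat_real (E k))" for k
    by (rule integrable_real_indicator) (auto simp: emeasure_eq_measure)
  then have int: "integrable M (\<lambda>x. c * indicat_real (E k) x)" for c k
    by (rule integrable_mult_right)
  have "AE x in M. real_cond_exp M (F n) (\<lambda>x. real (K (Suc n) x)) x
      = real_cond_exp M (F n) (\<lambda>x. \<Sum>k\<le>m. real k * indicat_real (E k) x) x"
  proof (rule real_cond_exp_cong)
    have "real (K (Suc n) x) = (\<Sum>k\<le>m. real k * indicat_real (E k) x)" if "x \<in> space M" for x
    proof -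
      have "(\<Sum>k\<le>m. real k * indicat_real (E k) x) = (\<Sum>k\<le>m. if K (Suc n) x = k then real k else 0)"
        using that by (intro sum.cong) (auto simp: E_def)
      also have "\<dots> = real (K (Suc n) x)"
        using K_le[OF that, of n] by (simp add: sum.delta)
      finally show ?thesis by simp
    qed
    then show "AE x in M. real (K (Suc n) x) = (\<Sum>k\<le>m. real k * indicat_real (E k) x)"
      by (rule AE_I2)
  qed (measurable, measurable)
  moreover have "AE x in M. real_cond_exp M (F n) (\<lambda>x. \<Sum>k\<le>m. real k * indicat_real (E k) x) x
      = (\<Sum>k\<le>m. real_cond_exp M (F n) (\<lambda>x. real k * indicat_real (E k) x) x)"
    by (rule real_cond_exp_sum[OF int])
  moreover have "AE x in M. \<forall>k\<in>{..m}. real_cond_exp M (F n) (\<lambda>x. real k * indicat_real (E k) x) x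
      = real k * sample_prob mdl m (balls n) (white n x) k"
  proof (rule AE_finite_allI)
    fix k assume "k \<in> {..m}"
    then have "AE x in M. real_cond_exp M (F n) (indicat_real (E k)) x = sample_prob mdl m (balls n) (white n x) k"
      unfolding E_def using cond_prob by simp
    moreover have "AE x in M. real_cond_exp M (F n) (\<lambda>x. real k * indicat_real (E k) x) x
        = real k * real_cond_exp M (F n) (indicat_real (E k)) x"
      by (rule real_cond_exp_cmult[OF int_E])
    ultimately show "AE x in M. real_cond_exp M (F n) (\<lambda>x. real k * indicat_real (E k) x) x
      = real k * sample_prob mdl m (balls n) (white n x) k"
      by eventually_elim simp
  qed simp
  ultimately show ?thesis
    using AE_sample_mean[of n] by eventually_elim simp
qed

text \<open>The draw at time \<open>n + 1\<close> minus its conditional mean, scaled by the slope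
  \<open>h\<close> and by the factor of the new time.\<close>

definition D :: "nat \<Rightarrow> 'w \<Rightarrow> real" where
  "D n x = g (Suc n) * h * (real (K (Suc n) x) - real m * W n x / T n)"

lemma mean_integrable: "integrable M (\<lambda>x. real m * W n x / T n)"
  using W_integrable[of n] by auto

lemma D_adapted: "D n \<in> borel_measurable (F (Suc n))"
proof -
  have [measurable]: "K (Suc n) \<in> F (Suc n) \<rightarrow>\<^sub>M count_space UNIV"
    by (rule draw_measurable) auto
  have [measurable]: "white n \<in> F (Suc n) \<rightarrow>\<^sub>M count_space UNIV"
    by (rule measurable_from_subalg[OF draw_algebra_Suc white_balls_measurable])
  show ?thesis unfolding D_def by measurable
qed

lemma D_measurable [measurable]: "D n \<in> borel_measurable M"
  by (rule measurable_from_subalg[OF draw_subalg D_adapted])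

text \<open>The draw lies between 0 and \<open>m\<close>, and so does its conditional mean by
  monotonicity; this treats both sampling models at once.\<close>

lemma D_bounded: "AE x in M. (D n x)\<^sup>2 \<le> (g (Suc n))\<^sup>2 * (h * real m)\<^sup>2"
proof -
  interpret sigma_finite_subalgebra M "F n" by (rule sigma_finite_subalgebraI[OF draw_subalg])
  have "AE x in M. 0 \<le> real_cond_exp M (F n) (\<lambda>x. real (K (Suc n) x)) x"
    by (rule real_cond_exp_ge_c[OF K_integrable]) simp
  moreover have "AE x in M. real_cond_exp M (F n) (\<lambda>x. real (K (Suc n) x)) x \<le> m"
    by (rule real_cond_exp_le_c[OF K_integrable]) (simp add: K_le)
  ultimately show ?thesis
    using cond_mean[of n] AE_space
  proof eventually_elim
    case (elim x)
    then have "\<bar>real (K (Suc n) x) - real m * W n x / T n\<bar> \<le> real m"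
      using K_le[of x n] by linarith
    then have "(real (K (Suc n) x) - real m * W n x / T n)\<^sup>2 \<le> (real m)\<^sup>2"
      by (simp add: abs_le_square_iff[symmetric])
    then have "(g (Suc n) * h)\<^sup>2 * (real (K (Suc n) x) - real m * W n x / T n)\<^sup>2 \<le> (g (Suc n) * h)\<^sup>2 * (real m)\<^sup>2"
      by (rule mult_left_mono) simp
    then show ?case
      unfolding D_def by (simp only: power_mult_distrib mult_ac)
  qed
qed

lemma D_square_integrable: "integrable M (\<lambda>x. (D n x)\<^sup>2)"
  by (rule integrable_const_bound[of _ "(g (Suc n))\<^sup>2 * (h * real m)\<^sup>2"]) (use D_bounded in auto)

lemma D_cond_mean: "AE x in M. real_cond_exp M (F n) (D n) x = 0"
proof -
  interpret sigma_finite_subalgebra M "F n" by (rule sigma_finite_subalgebraI[OF draw_subalg])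
  have "(\<lambda>x. real m * W n x / T n) \<in> borel_measurable (F n)"
    by (rule measurable_compose[OF white_balls_measurable]) simp
  then have "AE x in M. real_cond_exp M (F n) (\<lambda>x. real m * W n x / T n) x = real m * W n x / T n"
    by (rule real_cond_exp_F_meas[OF mean_integrable])
  moreover have "AE x in M. real_cond_exp M (F n) (\<lambda>x. real (K (Suc n) x) - real m * W n x / T n) x
    = real_cond_exp M (F n) (\<lambda>x. real (K (Suc n) x)) x - real_cond_exp M (F n) (\<lambda>x. real m * W n x / T n) x"
    by (rule real_cond_exp_diff[OF K_integrable mean_integrable])
  moreover have "AE x in M. real_cond_exp M (F n) (D n) x
    = g (Suc n) * h * real_cond_exp M (F n) (\<lambda>x. real (K (Suc n) x) - real m * W n x / T n) x"
    unfolding D_def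
    by (rule real_cond_exp_cmult) (intro Bochner_Integration.integrable_diff K_integrable mean_integrable)
  ultimately show ?thesis
    using cond_mean[of n] by eventually_elim simp
qed

sublocale martingale_differences M F D
  by unfold_locales (rule draw_subalg draw_algebra_Suc D_adapted D_square_integrable D_cond_mean)+

text \<open>The mean of \<open>W\<close> obeys the same affine recursion as its conditional mean.
  Centring cancels the constant \<open>a m\<close>, and the remaining coefficient
  \<open>1 + m * h / T n\<close> equals \<open>g n / g (Suc n)\<close>, which is what the scaling is
  designed to absorb.\<close>

lemma normalized_white_eq_S:
  assumes "x \<in> space M"
  shows "normalized_white M m a \<sigma> W\<^sub>0 B\<^sub>0 K n x = S n x"
proof (induction n)
  case 0
  show ?case by (simp add: normalized_white_def S_def prob_space)
next
  case (Suc n)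
  interpret sigma_finite_subalgebra M "F n" by (rule sigma_finite_subalgebraI[OF draw_subalg])
  define EW where "EW = expectation (\<lambda>x. W n x)"
  have EK: "expectation (\<lambda>x. real (K (Suc n) x)) = real m * EW / T n"
  proof -
    have "expectation (\<lambda>x. real (K (Suc n) x)) = expectation (real_cond_exp M (F n) (\<lambda>x. real (K (Suc n) x)))"
      by (rule real_cond_exp_int(2)[OF K_integrable, symmetric])
    also have "\<dots> = expectation (\<lambda>x. real m * W n x / T n)"
      using cond_mean[of n] by (intro integral_cong_AE) auto
    finally show ?thesis by (simp add: EW_def)
  qed
  have "expectation (\<lambda>x. W (Suc n) x) = expectation (\<lambda>x. W n x + real_of_int (a m) + h * real (K (Suc n) x))"
    by (rule Bochner_Integration.integral_cong[OF refl W_Suc])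
  also have "\<dots> = EW + real_of_int (a m) + h * (real m * EW / T n)"
    using W_integrable K_integrable EK by (simp add: prob_space EW_def)
  finally have E_Suc: "expectation (\<lambda>x. W (Suc n) x) = EW + real_of_int (a m) + h * (real m * EW / T n)" .
  define t where "t = T n"
  have t: "t > 0" "t + real m * h > 0"
    unfolding t_def using total_pos[of n] scaled_total_pos[of n] by simp_all
  have g_Suc: "g (Suc n) = g n * (t / (t + real m * h))"
    by (simp add: urn_scaling_def t_def)
  have g: "g n = g (Suc n) * (t + real m * h) / t"
    unfolding g_Suc using t by simp
  have "normalized_white M m a \<sigma> W\<^sub>0 B\<^sub>0 K (Suc n) x
      = g (Suc n) * (W n x + h * real (K (Suc n) x) - EW - h * (real m * EW / t))"
    unfolding normalized_white_def E_Suc W_Suc[OF assms] t_def by simp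
  also have "\<dots> = g n * (W n x - EW) + D n x"
    unfolding g D_def t_def[symmetric] using t by (simp add: field_simps)
  also have "g n * (W n x - EW) = S n x"
    using Suc by (simp add: normalized_white_def EW_def)
  finally show ?case by (simp add: S_def)
qed

lemma summable_variance:
  assumes "1 / 2 < urn_index m a \<sigma>"
  shows "summable (\<lambda>n. \<integral>x. (D n x)\<^sup>2 \<partial>M)"
proof (rule summable_comparison_test')
  have "g n = (\<Prod>j<n. (real (W\<^sub>0 + B\<^sub>0) + \<sigma> * real j) / (real (W\<^sub>0 + B\<^sub>0) + \<sigma> * real j + real m * h))" for n
    by (simp add: urn_scaling_def total_balls_def)
  \<comment> \<open>The large index condition, cleared of its denominator.\<close>
  moreover have "\<sigma> < 2 * (real m * h)"
    using assms \<sigma>_pos by (simp add: urn_index_def field_simps)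
  ultimately have "summable (\<lambda>n. (g (Suc n))\<^sup>2)"
    using summable_square_scaling[of "real (W\<^sub>0 + B\<^sub>0)" \<sigma> "real m * h"] m_pos start \<sigma>_pos by simp
  then show "summable (\<lambda>n. (g (Suc n))\<^sup>2 * (h * real m)\<^sup>2)"
    by (rule summable_mult2)
  fix n
  have "(\<integral>x. (D n x)\<^sup>2 \<partial>M) \<le> (\<integral>x. (g (Suc n))\<^sup>2 * (h * real m)\<^sup>2 \<partial>M)"
    by (intro integral_mono_AE D_square_integrable D_bounded) simp
  then show "norm (\<integral>x. (D n x)\<^sup>2 \<partial>M) \<le> (g (Suc n))\<^sup>2 * (h * real m)\<^sup>2"
    by (simp add: prob_space)
qed

end

theorem theorem2:
  fixes M :: "'w measure"
    and mdl :: sampling_model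
    and m W\<^sub>0 B\<^sub>0 :: nat
    and a b :: "nat \<Rightarrow> int"
    and \<sigma> :: int
    and K :: "nat \<Rightarrow> 'w \<Rightarrow> nat"
  assumes "m \<ge> 1" and "\<sigma> \<ge> 1" and "W\<^sub>0 + B\<^sub>0 \<ge> m"
    and "balanced_urn m a b \<sigma>"
    and "tenable_urn mdl m a b"
    and "affine_urn m a"
    and "nontriangular_urn m a b"
    and "int (W\<^sub>0 + B\<^sub>0) + int m * (a (m - 1) - a m) > 0"
    and "1 / 2 < urn_index m a \<sigma>" and "urn_index m a \<sigma> < 1"
    and "urn_process M mdl m a \<sigma> W\<^sub>0 B\<^sub>0 K"
  shows "\<exists>W_lim :: 'w \<Rightarrow> real.
           (AE \<omega> in M. (\<lambda>n. normalized_white M m a \<sigma> W\<^sub>0 B\<^sub>0 K n \<omega>) \<longlonglongrightarrow> W_lim \<omega>) \<and>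
           converges_L2 M (normalized_white M m a \<sigma> W\<^sub>0 B\<^sub>0 K) W_lim"
proof -
  interpret affine_urn_process M mdl m W\<^sub>0 B\<^sub>0 a b \<sigma> K
    using assms by unfold_locales
  let ?N = "normalized_white M m a \<sigma> W\<^sub>0 B\<^sub>0 K"
  obtain L where L: "AE x in M. (\<lambda>n. S n x) \<longlonglongrightarrow> L x" "converges_L2 M S L"
    using convergence[OF summable_variance[OF assms(9)]] .
  have "AE x in M. (\<lambda>n. ?N n x) \<longlonglongrightarrow> L x"
    using L(1) AE_space by eventually_elim (simp add: normalized_white_eq_S)
  moreover have "converges_L2 M ?N L"
  proof -
    \<comment> \<open>The two processes are known to agree only on the space of \<open>M\<close>, so
      measurability and integrals are transferred by congruence.\<close>
    have "square_integrable M (?N n) \<longleftrightarrow> square_integrable M (S n)" for n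
      unfolding square_integrable_def
      by (intro arg_cong2[where f = "(\<and>)"] measurable_cong Bochner_Integration.integrable_cong refl)
        (simp_all add: normalized_white_eq_S)
    moreover have "(\<integral>x. (?N n x - L x)\<^sup>2 \<partial>M) = (\<integral>x. (S n x - L x)\<^sup>2 \<partial>M)" for n
      by (rule Bochner_Integration.integral_cong) (simp_all add: normalized_white_eq_S)
    ultimately show ?thesis
      using L(2) by (simp add: converges_L2_def)
  qed
  ultimately show ?thesis by blast
qed

end
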